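(* Let $\Omega\subset\mathbb{R}^n$ be a bounded convex subset and let $f:\Omega\to\mathbb{R}$ be a convex function. Then $f$ can be extended to a convex function $\mathbb{R}^n\to\mathbb{R}$ on the whole linear space if and only if $f$ is a Lipschitz function on $\Omega$.
   Context: All functions are real valued and never take the values $\pm\infty$; in particular the extension is required to be finite everywhere. *)

theory Defs
  imports "HOL-Analysis.Analysis"
begin

end

(* A convex function that is bounded on the unit neighbourhood of a set is Lipschitz on that set:
   prolonging the segment from x to y by one unit beyond y and using convexity bounds f y - f x.
   A finite convex function on the whole space is continuous, hence bounded on compact balls.
   Conversely, an L-Lipschitz convex f on Omega is extended by the infimal convolution
   F x = inf {f y + L * |x - y| : y in Omega}, which is finite thanks to the Lipschitz bound. *)

theory Submission
  imports Defs
begin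

lemma convex_on_bounded_imp_lipschitz_on:
  fixes f :: "'a::real_normed_vector \<Rightarrow> real"
  assumes f: "convex_on S f" and M: "\<And>x. x \<in> S \<Longrightarrow> \<bar>f x\<bar> \<le> M" "0 \<le> M"
    and T: "\<And>x. x \<in> T \<Longrightarrow> cball x 1 \<subseteq> S"
  shows "(2 * M)-lipschitz_on T f"
proof -
  have one_sided: "f y - f x \<le> 2 * M * dist x y" if x: "x \<in> T" and y: "y \<in> T" for x y
  proof (cases "x = y")
    case False
    define d where "d = norm (y - x)"
    \<comment> \<open>The point \<open>z\<close> lies on the ray from \<open>x\<close> through
      \<open>y\<close>, one unit beyond \<open>y\<close>, so its distance from \<open>x\<close> is
      \<open>1 + d\<close>. The weight \<open>t\<close> is the ratio of distances that makes
      \<open>y\<close> the convex combination of \<open>x\<close> and \<open>z\<close>.\<close>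
    define t where "t = d / (1 + d)"
    define z where "z = x + (1 / t) *\<^sub>R (y - x)"
    have d: "d > 0" using False by (simp add: d_def)
    have t: "0 < t" "t \<le> 1" "t \<le> d" using d by (auto simp: t_def field_simps)
    have "z - y = (1 / t - 1) *\<^sub>R (y - x)" by (simp add: z_def algebra_simps)
    moreover have "1 / t - 1 = 1 / d" using d by (simp add: t_def field_simps)
    ultimately have "norm (z - y) = 1" using d by (simp add: d_def)
    then have z: "z \<in> S" using T[OF y] by (auto simp: dist_norm norm_minus_commute)
    have xS: "x \<in> S" using T[OF x] by auto
    have "(1 - t) *\<^sub>R x + t *\<^sub>R z = y" using t by (simp add: z_def algebra_simps)
    then have "f y \<le> (1 - t) * f x + t * f z"
      using convex_onD[OF f, of t x z] t xS z by simp
    then have "f y - f x \<le> t * (f z - f x)" by (simp add: algebra_simps)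
    also have "\<dots> \<le> t * (2 * M)"
      using M(1)[OF xS] M(1)[OF z] t by (intro mult_left_mono) auto
    also have "\<dots> \<le> d * (2 * M)" using t M(2) by (intro mult_right_mono) auto
    finally show ?thesis by (simp add: d_def dist_norm norm_minus_commute mult.commute)
  qed simp
  show ?thesis
  proof (rule lipschitz_onI)
    fix x y assume "x \<in> T" "y \<in> T"
    then show "dist (f x) (f y) \<le> 2 * M * dist x y"
      using one_sided[of x y] one_sided[of y x] by (auto simp: dist_real_def dist_commute)
  qed (use M in simp)
qed

lemma convex_on_UNIV_imp_lipschitz_on_bounded:
  fixes f :: "'a::euclidean_space \<Rightarrow> real"
  assumes f: "convex_on UNIV f" and T: "bounded T"
  shows "\<exists>L. L-lipschitz_on T f"
proof -
  obtain r where r: "T \<subseteq> cball 0 r"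
    using T by (auto simp: bounded_iff subset_iff)
  \<comment> \<open>Radius \<open>r + 1\<close> rather than \<open>r\<close> leaves room for the
    unit ball around each point of \<open>T\<close>.\<close>
  have "continuous_on (cball 0 (r + 1)) f"
    using convex_on_continuous[OF open_UNIV f] continuous_on_subset by blast
  then have "bounded (f ` cball 0 (r + 1))"
    by (intro compact_imp_bounded compact_continuous_image compact_cball)
  then obtain M where M: "M > 0" "\<And>x. x \<in> cball 0 (r + 1) \<Longrightarrow> \<bar>f x\<bar> \<le> M"
    by (auto simp: bounded_pos)
  have "(2 * M)-lipschitz_on T f"
  proof (rule convex_on_bounded_imp_lipschitz_on)
    show "convex_on (cball 0 (r + 1)) f"
      using f by (rule convex_on_subset) auto
    show "cball x 1 \<subseteq> cball 0 (r + 1)" if "x \<in> T" for x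
      using r that by (subst cball_subset_cball_iff) (auto simp: dist_commute)
  qed (use M in auto)
  then show ?thesis by blast
qed

text \<open>The function \<open>G\<close> below is jointly convex in both arguments, and minimising
  a jointly convex function over one argument over a convex set preserves convexity. The Lipschitz
  bound keeps the infimum finite and makes it equal to \<open>f\<close> on \<open>S\<close>.\<close>

lemma convex_on_lipschitz_on_extension:
  fixes f :: "'a::real_normed_vector \<Rightarrow> real"
  assumes f: "convex_on S f" and L: "L-lipschitz_on S f"
  shows "\<exists>F. convex_on UNIV F \<and> (\<forall>x\<in>S. F x = f x)"
proof (cases "S = {}")
  \<comment> \<open>An infimum over the empty set of reals carries no information, so this case gets
    the zero function.\<close>
  case True
  then show ?thesis by (intro exI[of _ "\<lambda>_. 0"]) (simp add: convex_on_def)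
next
  case False
  define G where "G x y = f y + L * norm (x - y)" for x y
  define F where "F x = (INF y\<in>S. G x y)" for x
  have L0: "0 \<le> L" using L by (rule lipschitz_on_nonneg)
  have S: "convex S" using f by (rule convex_on_imp_convex)
  have lip: "f a \<le> f b + L * norm (a - b)" if "a \<in> S" "b \<in> S" for a b
    using lipschitz_onD[OF L that] by (auto simp: dist_norm)
  have bdd: "bdd_below (G x ` S)" for x
  proof -
    obtain a where a: "a \<in> S" using False by blast
    \<comment> \<open>With \<open>a\<close> fixed, this lower bound does not depend on
      \<open>y\<close>.\<close>
    have "f a - L * norm (x - a) \<le> G x y" if y: "y \<in> S" for y
    proof -
      have "norm (a - y) \<le> norm (x - a) + norm (x - y)"
        using norm_triangle_ineq4[of "x - y" "x - a"] by simp
      from mult_left_mono[OF this L0] lip[OF a y] show ?thesis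
        by (simp add: G_def algebra_simps)
    qed
    then show ?thesis by (auto simp: bdd_below_def)
  qed
  have F_le: "F x \<le> G x y" if "y \<in> S" for x y
    unfolding F_def by (rule cINF_lower[OF bdd that])
  have near: "\<exists>y\<in>S. G x y < F x + e" if "e > 0" for x e
    using cInf_lessD[of "G x ` S" "F x + e"] False that by (auto simp: F_def)
  have "F x = f x" if x: "x \<in> S" for x
  proof (rule antisym)
    show "F x \<le> f x" using F_le[OF x, of x] by (simp add: G_def)
    show "f x \<le> F x"
      unfolding F_def by (rule cINF_greatest[OF False]) (simp add: G_def lip x)
  qed
  moreover have "convex_on UNIV F"
  proof (rule convex_onI)
    fix t :: real and x y :: 'a assume t: "0 < t" "t < 1"
    show "F ((1 - t) *\<^sub>R x + t *\<^sub>R y) \<le> (1 - t) * F x + t * F y"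
    \<comment> \<open>The infima need not be attained, so \<open>a\<close> and \<open>b\<close> are
      minimisers up to \<open>e\<close>; their convex combination \<open>c\<close> is the competitor
      at the combined point. Since the weights sum to 1, the total error is again
      \<open>e\<close>.\<close>
    proof (rule field_le_epsilon)
      fix e :: real assume e: "0 < e"
      obtain a where a: "a \<in> S" "G x a < F x + e" using near[OF e] by blast
      obtain b where b: "b \<in> S" "G y b < F y + e" using near[OF e] by blast
      define c where "c = (1 - t) *\<^sub>R a + t *\<^sub>R b"
      have c: "c \<in> S" unfolding c_def using convexD_alt[OF S a(1) b(1)] t by simp
      have fc: "f c \<le> (1 - t) * f a + t * f b"
        unfolding c_def using convex_onD[OF f] t a b by simp
      have "(1 - t) *\<^sub>R x + t *\<^sub>R y - c = (1 - t) *\<^sub>R (x - a) + t *\<^sub>R (y - b)"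
        by (simp add: c_def algebra_simps)
      then have nc: "norm ((1 - t) *\<^sub>R x + t *\<^sub>R y - c) \<le> (1 - t) * norm (x - a) + t * norm (y - b)"
        using norm_triangle_ineq[of "(1 - t) *\<^sub>R (x - a)" "t *\<^sub>R (y - b)"] t by simp
      have "F ((1 - t) *\<^sub>R x + t *\<^sub>R y) \<le> G ((1 - t) *\<^sub>R x + t *\<^sub>R y) c"
        by (rule F_le[OF c])
      also have "\<dots> \<le> (1 - t) * G x a + t * G y b"
        using fc mult_left_mono[OF nc L0] by (simp add: G_def algebra_simps)
      also have "\<dots> \<le> (1 - t) * (F x + e) + t * (F y + e)"
        using a b t by (intro add_mono mult_left_mono) auto
      also have "\<dots> = (1 - t) * F x + t * F y + e" by (simp add: algebra_simps)
      finally show "F ((1 - t) *\<^sub>R x + t *\<^sub>R y) \<le> (1 - t) * F x + t * F y + e" .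
    qed
  qed simp
  ultimately show ?thesis by blast
qed

theorem theorem4p1:
  fixes \<Omega> :: "(real ^ 'n) set" and f :: "real ^ 'n \<Rightarrow> real"
  assumes "bounded \<Omega>" and "convex \<Omega>" and "convex_on \<Omega> f"
  shows "(\<exists>F :: real ^ 'n \<Rightarrow> real. convex_on UNIV F \<and> (\<forall>x\<in>\<Omega>. F x = f x))
    \<longleftrightarrow> (\<exists>L. L-lipschitz_on \<Omega> f)"
proof
  assume "\<exists>F :: real ^ 'n \<Rightarrow> real. convex_on UNIV F \<and> (\<forall>x\<in>\<Omega>. F x = f x)"
  then obtain F :: "real ^ 'n \<Rightarrow> real" where F: "convex_on UNIV F" "\<forall>x\<in>\<Omega>. F x = f x" by blast
  \<comment> \<open>Boundedness of \<Omega> enters here: a finite convex function such as the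
    squared norm need not be Lipschitz on the whole space.\<close>
  obtain L where "L-lipschitz_on \<Omega> F"
    using convex_on_UNIV_imp_lipschitz_on_bounded[OF F(1) assms(1)] by blast
  then have "L-lipschitz_on \<Omega> f" by (rule lipschitz_on_transform) (use F(2) in simp)
  then show "\<exists>L. L-lipschitz_on \<Omega> f" by blast
next
  assume "\<exists>L. L-lipschitz_on \<Omega> f"
  then show "\<exists>F :: real ^ 'n \<Rightarrow> real. convex_on UNIV F \<and> (\<forall>x\<in>\<Omega>. F x = f x)"
    using convex_on_lipschitz_on_extension[OF assms(3)] by blast
qed

end
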